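(* For $k\ge1$ and $n\ge0$, the prefix of $x_k$ of length $n$ satisfies $x_k[0{:}n)=W_k(D_k(n))$. Moreover, for all $q\ge0$, $\tau_k^q(x_k[0{:}n))=W_k(D_k(n)+q)$, where $D_k(n)+q=\{p+q:p\in D_k(n)\}$.
   Context: For $k\ge1$, $\tau_k$ is the substitution on the alphabet $\{1,\ldots,k\}$ given by $\tau_k(k)=k1$ and $\tau_k(i)=i+1$ for $1\le i<k$, extended to words morphically, and $x_k=x_k[0]x_k[1]\cdots$ is the infinite fixed point of $\tau_k$; $x_k[0{:}n)=x_k[0]\cdots x_k[n-1]$. The sequence $(A_{k,p})_{p\ge0}$ is defined by $A_{k,p}=p+1$ for $0\le p<k$ and $A_{k,p}=A_{k,p-1}+A_{k,p-k}$ for $p\ge k$. For $n\ge0$, $D_k(n)$ denotes the unique finite set $D\subset\mathbb{N}$ whose elements are pairwise at distance at least $k$ and such that $\sum_{p\in D}A_{k,p}=n$. For a finite set $D=\{p_0<p_1<\cdots<p_m\}\subset\mathbb{N}$, $W_k(D)$ is the word $\tau_k^{p_m}(k)\,\tau_k^{p_{m-1}}(k)\cdots\tau_k^{p_0}(k)$ (the empty word if $D=\varnothing$). *)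

theory Defs
  imports Main "HOL-Library.Stream"
begin

text \<open>Letters are natural numbers. The value of \<open>tau k\<close> outside the alphabet \<open>{1..k}\<close> is
  irrelevant: \<open>tau k\<close> maps letters of \<open>{1..k}\<close> to words over \<open>{1..k}\<close>.\<close>

definition tau :: "nat \<Rightarrow> nat \<Rightarrow> nat list" where
  "tau k i = (if i = k then [k, 1] else [i + 1])"

definition tau_word :: "nat \<Rightarrow> nat list \<Rightarrow> nat list" where
  "tau_word k w = concat (map (tau k) w)"

text \<open>Since \<open>tau k\<close> is non-erasing, \<open>flat (smap (tau k) s)\<close> is the image of the infinite word \<open>s\<close>
  under the morphic extension of \<open>tau k\<close>. For \<open>k \<ge> 1\<close> the fixed point is unique: its first letter
  must be \<open>k\<close>, the only letter that begins its own image.\<close>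

definition xfix :: "nat \<Rightarrow> nat stream" where
  "xfix k = (THE s. sset s \<subseteq> {1..k} \<and> flat (smap (tau k) s) = s)"

text \<open>The disjunct \<open>k = 0\<close> only serves termination.\<close>

function Aseq :: "nat \<Rightarrow> nat \<Rightarrow> nat" where
  "Aseq k p = (if p < k \<or> k = 0 then p + 1 else Aseq k (p - 1) + Aseq k (p - k))"
  by pat_completeness auto
termination by (relation "measure snd") auto

declare Aseq.simps [simp del]

definition Dset :: "nat \<Rightarrow> nat \<Rightarrow> nat set" where
  "Dset k n = (THE S. finite S \<and> (\<forall>p\<in>S. \<forall>r\<in>S. p < r \<longrightarrow> k \<le> r - p) \<and> (\<Sum>p\<in>S. Aseq k p) = n)"

definition Wword :: "nat \<Rightarrow> nat set \<Rightarrow> nat list" where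
  "Wword k S = concat (map (\<lambda>p. (tau_word k ^^ p) [k]) (rev (sorted_list_of_set S)))"

end

theory Submission
  imports Defs "HOL-Library.Sublist" "HOL-Library.Infinite_Set"
begin

text \<open>
  The words \<open>\<tau>\<^sup>p(k)\<close> satisfy \<open>\<tau>\<^sup>p\<^sup>+\<^sup>1(k) = \<tau>\<^sup>p(k) \<tau>\<^sup>p(1)\<close>, and \<open>\<tau>\<^sup>k\<^sup>-\<^sup>1(1) = k\<close> turns the second factor
  into \<open>\<tau>\<^sup>p\<^sup>+\<^sup>1\<^sup>-\<^sup>k(k)\<close> once \<open>p + 1 \<ge> k\<close>. Hence they have length \<open>A\<^sub>p\<close>, are prefixes of each other and of
  the fixed point, and removing the largest element of a \<open>k\<close>-separated set \<open>S\<close> below \<open>p + 1\<close> shows by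
  induction that \<open>W(S)\<close> is a prefix of \<open>\<tau>\<^sup>p\<^sup>+\<^sup>1(k)\<close>. Its length is the sum of the \<open>A\<^sub>r\<close> over \<open>r \<in> S\<close>, so
  it is the prefix of the fixed point of that length.
\<close>

section \<open>The substitution as a morphism on finite words\<close>

lemma tau_word_append [simp]: "tau_word k (u @ v) = tau_word k u @ tau_word k v"
  by (simp add: tau_word_def)

lemma tau_word_Nil [simp]: "tau_word k [] = []"
  by (simp add: tau_word_def)

lemma tau_word_funpow_append:
  "(tau_word k ^^ q) (u @ v) = (tau_word k ^^ q) u @ (tau_word k ^^ q) v"
  by (induction q) simp_all

lemma tau_word_funpow_Nil [simp]: "(tau_word k ^^ q) [] = []"
  by (induction q) simp_all

lemma tau_word_funpow_concat:
  "(tau_word k ^^ q) (concat ws) = concat (map (tau_word k ^^ q) ws)"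
  by (induction ws) (simp_all add: tau_word_funpow_append)

lemma set_tau_word:
  assumes "k \<ge> 1" "set w \<subseteq> {1..k}"
  shows "set (tau_word k w) \<subseteq> {1..k}"
  using assms by (fastforce simp: tau_word_def tau_def split: if_splits)


section \<open>The words \<open>\<tau>\<^sup>p(k)\<close>\<close>

definition block :: "nat \<Rightarrow> nat \<Rightarrow> nat list" where
  "block k p = (tau_word k ^^ p) [k]"

lemma block_0: "block k 0 = [k]"
  by (simp add: block_def)

lemma tau_word_block: "tau_word k (block k p) = block k (Suc p)"
  by (simp add: block_def)

lemma set_block: "k \<ge> 1 \<Longrightarrow> set (block k p) \<subseteq> {1..k}"
proof (induction p)
  case (Suc p)
  then show ?case
    using set_tau_word[of k "block k p"] by (simp add: tau_word_block)
qed (simp add: block_0)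

lemma tau_word_funpow_1: "p < k \<Longrightarrow> (tau_word k ^^ p) [1] = [Suc p]"
  by (induction p) (simp_all add: tau_word_def tau_def)

lemma block_Suc: "block k (Suc p) = block k p @ (tau_word k ^^ p) [1]"
proof -
  have "block k (Suc p) = (tau_word k ^^ p) (tau_word k [k])"
    by (simp only: block_def funpow_Suc_right o_apply)
  also have "tau_word k [k] = [k] @ [1]"
    by (simp add: tau_word_def tau_def)
  finally show ?thesis
    by (simp only: tau_word_funpow_append block_def)
qed

lemma block_Suc_large:
  assumes "k \<ge> 1" "k \<le> Suc p"
  shows "block k (Suc p) = block k p @ block k (Suc p - k)"
proof -
  \<comment> \<open>Here \<open>p\<close> is split as \<open>(Suc p - k) + (k - 1)\<close>; the
    \<open>k - 1\<close> inner steps raise the letter \<open>1\<close> to \<open>k\<close>.\<close>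
  have "(tau_word k ^^ p) [1] = (tau_word k ^^ (Suc p - k)) ((tau_word k ^^ (k - 1)) [1])"
    using assms by (simp flip: funpow_add[unfolded fun_eq_iff o_apply, rule_format])
  also have "(tau_word k ^^ (k - 1)) [1] = [k]"
    using assms tau_word_funpow_1[of "k - 1" k] by simp
  finally show ?thesis
    by (simp only: block_Suc[of k p]) (simp add: block_def)
qed

section \<open>The sequence \<open>A\<close> and the lengths of the blocks\<close>

lemma Aseq_0: "Aseq k 0 = 1"
  by (subst Aseq.simps) auto

text \<open>For \<open>p + 1 < k\<close> the truncated index \<open>p + 1 - k\<close> is \<open>0\<close>, and \<open>A\<^sub>0 = 1\<close> is the right increment.\<close>

lemma Aseq_Suc:
  assumes "k \<ge> 1"
  shows "Aseq k (Suc p) = Aseq k p + Aseq k (Suc p - k)"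
  using assms by (cases "Suc p < k") (simp_all add: Aseq.simps[of k "Suc p"] Aseq.simps[of k p] Aseq_0)

lemma Aseq_pos: "k \<ge> 1 \<Longrightarrow> Aseq k p > 0"
  by (induction p) (simp_all add: Aseq_0 Aseq_Suc)

text \<open>This makes \<open>n\<close> itself a bound for the indices needed to represent
  \<open>n\<close>, and puts position \<open>n\<close> inside \<open>block k n\<close>.\<close>

lemma less_Aseq: "k \<ge> 1 \<Longrightarrow> p < Aseq k p"
proof (induction p)
  case (Suc p)
  then show ?case
    using Aseq_pos[of k "Suc p - k"] Aseq_Suc[of k p] by linarith
qed (simp add: Aseq_0)

text \<open>The recurrences reach back \<open>k\<close> steps, hence strong induction. Up to
  \<open>p < k\<close>, each step adds a single letter, matching
  \<open>A\<^sub>p = p + 1\<close>.\<close>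

lemma length_block:
  assumes "k \<ge> 1"
  shows "length (block k p) = Aseq k p"
proof (induction p rule: less_induct)
  case (less p)
  show ?case
  proof (cases p)
    case 0
    then show ?thesis by (simp add: block_0 Aseq_0)
  next
    case (Suc m)
    show ?thesis
    proof (cases "k \<le> p")
      case True
      then show ?thesis
        using assms Suc less[of m] less[of "p - k"] by (simp add: block_Suc_large Aseq_Suc)
    next
      case False
      then show ?thesis
        using assms Suc less[of m]
        by (simp add: block_Suc tau_word_funpow_1 Aseq_Suc Aseq_0 del: One_nat_def)
    qed
  qed
qed

lemma prefix_block: "p \<le> q \<Longrightarrow> prefix (block k p) (block k q)"
proof (induction q rule: dec_induct)
  case (step q)
  then show ?case by (simp add: block_Suc)
qed simp


section \<open>Separated sets and the numeration system of \<open>A\<close>\<close>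

definition separated :: "nat \<Rightarrow> nat set \<Rightarrow> bool" where
  "separated k S \<longleftrightarrow> finite S \<and> (\<forall>p\<in>S. \<forall>r\<in>S. p < r \<longrightarrow> k \<le> r - p)"

lemma separated_subset: "separated k S \<Longrightarrow> R \<subseteq> S \<Longrightarrow> separated k R"
  unfolding separated_def by (meson finite_subset subsetD)

text \<open>The bound on \<open>S\<close> says \<open>r + k \<le> p\<close> for every
  \<open>r\<close> in \<open>S\<close>. If \<open>Suc p \<le> k\<close>, truncated subtraction makes
  it force \<open>S = {}\<close>.\<close>

lemma separated_insert:
  assumes "separated k S" "S \<subseteq> {..<Suc p - k}"
  shows "separated k (insert p S)"
  unfolding separated_def
proof (intro conjI ballI impI)
  show "finite (insert p S)" using assms by (simp add: separated_def)
next
  fix a b assume ab: "a \<in> insert p S" "b \<in> insert p S" "a < b"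
  then consider "a \<in> S" "b \<in> S" | "a \<in> S" "b = p" | "a = p" "b \<in> S"
    by blast
  then show "k \<le> b - a"
  proof cases
    case 1
    then show ?thesis using assms ab by (simp add: separated_def)
  next
    case 2
    then show ?thesis using assms by auto
  next
    case 3
    then show ?thesis using assms ab by auto
  qed
qed

lemma separated_remove_max:
  assumes "separated k S" "S \<subseteq> {..<Suc p}" "p \<in> S" "k \<ge> 1"
  shows "separated k (S - {p})" "S - {p} \<subseteq> {..<Suc p - k}"
proof -
  show "separated k (S - {p})"
    using assms separated_subset by blast
  show "S - {p} \<subseteq> {..<Suc p - k}"
  proof
    fix r assume r: "r \<in> S - {p}"
    then have "r < p" using assms by force
    then have "k \<le> p - r" using assms r by (simp add: separated_def)
    then show "r \<in> {..<Suc p - k}" using \<open>r < p\<close> by simp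
  qed
qed

text \<open>Either the top index \<open>p\<close> is absent, or removing it leaves a set below
  \<open>Suc p - k\<close>. These cases follow the two terms of the recurrences for
  \<open>Aseq\<close> and \<open>block\<close>, so sums and words can both be treated by this
  rule.\<close>

lemma separated_induct [consumes 3, case_names empty skip insert]:
  assumes "k \<ge> 1" "separated k S" "S \<subseteq> {..<p}"
    and empty: "P 0 {}"
    and skip: "\<And>p S. separated k S \<Longrightarrow> S \<subseteq> {..<p} \<Longrightarrow> P p S \<Longrightarrow> P (Suc p) S"
    and ins: "\<And>p S. separated k S \<Longrightarrow> S \<subseteq> {..<Suc p - k} \<Longrightarrow> P (Suc p - k) S \<Longrightarrow> P (Suc p) (insert p S)"
  shows "P p S"
  using assms(2,3)
proof (induction p arbitrary: S rule: less_induct)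
  case (less p)
  show ?case
  proof (cases p)
    case 0
    then show ?thesis using less.prems empty by simp
  next
    case (Suc m)
    show ?thesis
    proof (cases "m \<in> S")
      case True
      note rm = separated_remove_max[OF less.prems(1) less.prems(2)[unfolded Suc] True assms(1)]
      have "P (Suc m - k) (S - {m})"
        using less.IH[OF _ rm] assms(1) Suc by simp
      then have "P (Suc m) (insert m (S - {m}))"
        using ins rm by blast
      then show ?thesis using True Suc by (simp add: insert_absorb)
    next
      case False
      then have "S \<subseteq> {..<m}"
        using less.prems Suc less_Suc_eq by auto
      then show ?thesis
        using skip less Suc by simp
    qed
  qed
qed

lemma sum_Aseq_insert:
  assumes "separated k S" "S \<subseteq> {..<Suc p - k}" "k \<ge> 1"
  shows "(\<Sum>r\<in>insert p S. Aseq k r) = Aseq k p + (\<Sum>r\<in>S. Aseq k r)"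
  using assms by (subst sum.insert) (auto simp: separated_def)

text \<open>When \<open>p\<close> is inserted, the bound for the remaining set is
  \<open>Aseq k (Suc p - k)\<close>, exactly the second summand of \<open>Aseq_Suc\<close>.\<close>

lemma sum_Aseq_less:
  assumes "k \<ge> 1" "separated k S" "S \<subseteq> {..<p}"
  shows "(\<Sum>r\<in>S. Aseq k r) < Aseq k p"
  using assms
proof (induction rule: separated_induct)
  case (insert p S)
  then show ?case using assms(1) by (simp only: sum_Aseq_insert Aseq_Suc)
qed (use assms(1) in \<open>simp_all add: Aseq_0 Aseq_Suc\<close>)

text \<open>Greedy expansion: \<open>Aseq k m\<close> is taken when it fits, and the recurrence
  leaves a remainder below \<open>Aseq k (Suc m - k)\<close>, whose indices therefore keep distance
  \<open>k\<close> from \<open>m\<close>.\<close>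

lemma separated_exists:
  assumes "k \<ge> 1" "n < Aseq k p"
  shows "\<exists>S. separated k S \<and> S \<subseteq> {..<p} \<and> (\<Sum>r\<in>S. Aseq k r) = n"
  using assms(2)
proof (induction p arbitrary: n rule: less_induct)
  case (less p)
  show ?case
  proof (cases p)
    case 0
    then show ?thesis using less.prems by (intro exI[of _ "{}"]) (simp add: Aseq_0 separated_def)
  next
    case (Suc m)
    show ?thesis
    proof (cases "n < Aseq k m")
      case True
      then obtain S where "separated k S" "S \<subseteq> {..<m}" "(\<Sum>r\<in>S. Aseq k r) = n"
        using less.IH Suc by blast
      then show ?thesis using Suc by (intro exI[of _ S]) auto
    next
      case False
      then have "n - Aseq k m < Aseq k (Suc m - k)"
        using less.prems Aseq_Suc[OF assms(1), of m] unfolding Suc by linarith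
      then obtain S where S: "separated k S" "S \<subseteq> {..<Suc m - k}" "(\<Sum>r\<in>S. Aseq k r) = n - Aseq k m"
        using less.IH[of "Suc m - k"] Suc assms(1) by auto
      have "(\<Sum>r\<in>insert m S. Aseq k r) = n"
        using S False sum_Aseq_insert[OF S(1,2) assms(1)] by linarith
      moreover have "insert m S \<subseteq> {..<p}"
        using S Suc by auto
      ultimately show ?thesis
        using separated_insert[OF S(1,2)] by blast
    qed
  qed
qed

text \<open>By \<open>sum_Aseq_less\<close> the sum alone decides membership of the top index: it
  belongs to the set iff the sum is at least \<open>Aseq k p\<close>. It is then removed from both
  sets.\<close>

lemma separated_unique:
  assumes "k \<ge> 1" "separated k S" "S \<subseteq> {..<p}" "separated k R" "R \<subseteq> {..<p}"
    and "(\<Sum>r\<in>R. Aseq k r) = (\<Sum>r\<in>S. Aseq k r)"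
  shows "R = S"
  using assms(1-3) assms(4-)
proof (induction arbitrary: R rule: separated_induct)
  case empty
  then show ?case by simp
next
  case (skip p S)
  have "p \<notin> R"
  proof
    assume "p \<in> R"
    then have "Aseq k p \<le> (\<Sum>r\<in>R. Aseq k r)"
      using skip.prems by (intro member_le_sum) (auto simp: separated_def)
    then show False
      using skip.prems skip.hyps sum_Aseq_less[OF assms(1), of S p] by linarith
  qed
  then have "R \<subseteq> {..<p}"
    using skip.prems by (auto simp: less_Suc_eq)
  then show ?case using skip.IH skip.prems by blast
next
  case (insert p S)
  have sumS: "(\<Sum>r\<in>R. Aseq k r) = Aseq k p + (\<Sum>r\<in>S. Aseq k r)"
    using insert.prems(3) sum_Aseq_insert[OF insert.hyps assms(1)] by simp
  have "p \<in> R"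
  proof (rule ccontr)
    assume "p \<notin> R"
    then have "R \<subseteq> {..<p}"
      using insert.prems(2) by (auto simp: less_Suc_eq)
    then show False
      using sum_Aseq_less[OF assms(1) insert.prems(1), of p] sumS by linarith
  qed
  note rm = separated_remove_max[OF insert.prems(1,2) this assms(1)]
  have "(\<Sum>r\<in>R. Aseq k r) = Aseq k p + (\<Sum>r\<in>R - {p}. Aseq k r)"
    using insert.prems \<open>p \<in> R\<close> by (intro sum.remove) (auto simp: separated_def)
  then have "(\<Sum>r\<in>R - {p}. Aseq k r) = (\<Sum>r\<in>S. Aseq k r)"
    using sumS by linarith
  then have "R - {p} = S"
    by (rule insert.IH[OF rm])
  then show ?case using \<open>p \<in> R\<close> by blast
qed

lemma Dset_props:
  assumes "k \<ge> 1"
  shows "separated k (Dset k n)" "(\<Sum>p\<in>Dset k n. Aseq k p) = n"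
proof -
  let ?Q = "\<lambda>S. separated k S \<and> (\<Sum>p\<in>S. Aseq k p) = n"
  have "\<exists>S. ?Q S"
    using separated_exists[OF assms less_Aseq[OF assms]] by blast
  moreover have "S = R" if "?Q S" "?Q R" for S R
  proof -
    have "finite (S \<union> R)" using that by (simp add: separated_def)
    then obtain p where "S \<union> R \<subseteq> {..<p}"
      \<comment> \<open>Uniqueness is relative to a bound, so both sets are placed below a common
        one.\<close>
      using finite_nat_bounded by blast
    then show ?thesis using separated_unique[OF assms, of R p S] that by simp
  qed
  ultimately have "\<exists>!S. ?Q S"
    by blast
  then have "?Q (THE S. ?Q S)"
    by (rule theI')
  moreover have "Dset k n = (THE S. ?Q S)"
    by (simp add: Dset_def separated_def conj_assoc)
  ultimately show "separated k (Dset k n)" "(\<Sum>p\<in>Dset k n. Aseq k p) = n"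
    by simp_all
qed


section \<open>The words \<open>W(S)\<close>\<close>

lemma Wword_empty [simp]: "Wword k {} = []"
  by (simp add: Wword_def)

lemma Wword_insert_max:
  assumes "finite S" "S \<subseteq> {..<p}"
  shows "Wword k (insert p S) = block k p @ Wword k S"
proof -
  have "sorted_list_of_set (insert p S) = sorted_list_of_set S @ [p]"
    using assms by (intro sorted_distinct_set_unique) (auto simp: sorted_append less_imp_le simp del: sorted_list_of_set_insert_remove)
  then show ?thesis by (simp add: Wword_def block_def)
qed

lemma length_Wword:
  assumes "k \<ge> 1" "finite S"
  shows "length (Wword k S) = (\<Sum>p\<in>S. Aseq k p)"
  using assms(2)
proof (induction S rule: finite_linorder_max_induct)
  case (insert p S)
  then have "S \<subseteq> {..<p}" "p \<notin> S" by auto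
  then show ?case using insert assms(1) by (simp add: Wword_insert_max length_block)
qed simp

lemma prefix_Wword_block:
  assumes "k \<ge> 1" "separated k S" "S \<subseteq> {..<p}"
  shows "prefix (Wword k S) (block k p)"
  using assms
proof (induction rule: separated_induct)
  case empty
  then show ?case by simp
next
  case (skip p S)
  then show ?case using prefix_block[of p "Suc p" k] prefix_order.trans by fastforce
next
  case (insert p S)
  then have "finite S" "S \<subseteq> {..<p}"
    using assms(1) by (auto simp: separated_def)
  then have W: "Wword k (insert p S) = block k p @ Wword k S"
    by (rule Wword_insert_max)
  show ?case
  proof (cases "k \<le> Suc p")
    case True
    then show ?thesis using insert assms(1) by (simp add: W block_Suc_large)
  next
    case False
    \<comment> \<open>The truncated bound \<open>Suc p - k\<close> is \<open>0\<close> here, so the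
      word is just \<open>block k p\<close>.\<close>
    then have "S = {}" using insert by auto
    then show ?thesis unfolding W block_Suc by simp
  qed
qed

text \<open>Translation by \<open>q\<close> preserves the order of the indices, and on each factor
  the exponents of \<open>\<tau>\<close> add.\<close>

lemma tau_word_funpow_Wword:
  assumes "finite S"
  shows "(tau_word k ^^ q) (Wword k S) = Wword k ((\<lambda>p. p + q) ` S)"
proof -
  have "sorted_list_of_set ((\<lambda>p. p + q) ` S) = map (\<lambda>p. p + q) (sorted_list_of_set S)"
    using assms
    by (intro sorted_distinct_set_unique) (auto simp: sorted_map distinct_map)
  then show ?thesis
    by (simp add: Wword_def tau_word_funpow_concat rev_map o_def
        flip: funpow_add[unfolded fun_eq_iff o_apply, rule_format] add.commute[of q])
qed


section \<open>The infinite fixed point\<close>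

definition fixed_stream :: "nat \<Rightarrow> nat stream \<Rightarrow> bool" where
  "fixed_stream k s \<longleftrightarrow> sset s \<subseteq> {1..k} \<and> flat (smap (tau k) s) = s"

lemma flat_smap_tau_shift:
  "flat (smap (tau k) (w @- s)) = tau_word k w @- flat (smap (tau k) s)"
proof (induction w)
  case (Cons a w)
  \<comment> \<open>\<open>flat\<close> unfolds in this way only at a nonempty head;
    \<open>\<tau>\<close> is non-erasing.\<close>
  have "flat (tau k a ## t) = tau k a @- flat t" for t
    by (rule flat_Stream) (simp add: tau_def)
  then show ?case using Cons by (simp add: tau_word_def)
qed simp

lemma stream_eqI_snth:
  assumes "\<And>n. s !! n = t !! n"
  shows "s = t"
proof -
  have "snth s = snth t" using assms by (rule ext)
  then show ?thesis by (metis stream_smap_nats)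
qed

text \<open>Stated for every fixed stream, since it also yields uniqueness. Applying
  \<open>\<tau>\<close> leaves \<open>s\<close> unchanged and turns its prefix
  \<open>block k p\<close> into the next block.\<close>

lemma fixed_stream_block:
  assumes "k \<ge> 1" "fixed_stream k s"
  shows "\<exists>t. s = block k p @- t"
proof (induction p)
  case 0
  have s: "s = [shd s] @- stl s" by simp
  have "s = tau k (shd s) @- flat (smap (tau k) (stl s))"
    using assms(2) flat_smap_tau_shift[of k "[shd s]" "stl s"]
    by (simp add: fixed_stream_def tau_word_def)
  then have "shd s = hd (tau k (shd s))"
    by (metis list.distinct(1) shift_simps(1) tau_def)
  then have "shd s = k"
    by (auto simp: tau_def split: if_splits)
  then show ?case
    using s by (metis block_0)
next
  case (Suc p)
  then obtain t where "s = block k p @- t" ..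
  then have "flat (smap (tau k) s) = block k (Suc p) @- flat (smap (tau k) t)"
    by (simp only: flat_smap_tau_shift tau_word_block)
  then show ?case using assms(2) by (auto simp: fixed_stream_def)
qed

lemma nth_block_mono:
  assumes "k \<ge> 1" "p \<le> q" "n < Aseq k p"
  shows "block k q ! n = block k p ! n"
  using prefix_block[OF assms(2), of k] assms(1,3)
  by (auto simp: prefix_def nth_append length_block)

lemma fixed_stream_snth:
  assumes "k \<ge> 1" "fixed_stream k s"
  shows "s !! n = block k n ! n"
  using fixed_stream_block[OF assms, of n] less_Aseq[OF assms(1), of n] assms(1)
  by (auto simp: length_block)

lemma fixed_stream_exists:
  assumes "k \<ge> 1"
  shows "\<exists>s. fixed_stream k s"
proof -
  \<comment> \<open>Diagonal limit of the blocks: letter \<open>n\<close> is read off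
    \<open>block k n\<close>, which is long enough by \<open>less_Aseq\<close>.\<close>
  define s where "s = smap (\<lambda>n. block k n ! n) nats"
  have snth: "s !! n = block k n ! n" for n
    by (simp add: s_def)
  have "stake (Aseq k p) s = block k p" for p
  proof (rule nth_equalityI)
    fix n assume "n < length (stake (Aseq k p) s)"
    then have n: "n < Aseq k p" by simp
    \<comment> \<open>The indices \<open>p\<close> and \<open>n\<close> may come in either order;
      position \<open>n\<close> lies in both blocks, and one is a prefix of the other.\<close>
    show "stake (Aseq k p) s ! n = block k p ! n"
      using nth_block_mono[OF assms, of n p n] nth_block_mono[OF assms, of p n n]
        less_Aseq[OF assms, of n] n by (cases "n \<le> p") (simp_all add: snth)
  qed (use assms in \<open>simp add: length_block\<close>)
  then have s: "s = block k p @- sdrop (Aseq k p) s" for p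
    by (metis stake_sdrop)
  have "flat (smap (tau k) s) !! n = s !! n" for n
  proof -
    \<comment> \<open>The stream \<open>s\<close> and its image both start with
      \<open>block k (Suc n)\<close>, which covers position \<open>n\<close>.\<close>
    have "n < Aseq k (Suc n)"
      using less_Aseq[OF assms, of "Suc n"] by simp
    moreover have "flat (smap (tau k) s) = block k (Suc n) @- flat (smap (tau k) (sdrop (Aseq k n) s))"
      using arg_cong[OF s[of n], of "\<lambda>s. flat (smap (tau k) s)"]
      by (simp only: flat_smap_tau_shift tau_word_block)
    moreover have "s !! n = (block k (Suc n) @- sdrop (Aseq k (Suc n)) s) !! n"
      by (simp only: s[of "Suc n", symmetric])
    ultimately show ?thesis
      using assms by (simp add: length_block)
  qed
  then have "flat (smap (tau k) s) = s"
    by (rule stream_eqI_snth)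
  moreover have "s !! n \<in> {1..k}" for n
    using set_block[OF assms, of n] less_Aseq[OF assms, of n] assms
    by (metis length_block nth_mem snth subsetD)
  then have "sset s \<subseteq> {1..k}"
    by (auto simp only: sset_range)
  ultimately show ?thesis
    unfolding fixed_stream_def by blast
qed

lemma fixed_stream_xfix:
  assumes "k \<ge> 1"
  shows "fixed_stream k (xfix k)"
proof -
  have "s = t" if "fixed_stream k s" "fixed_stream k t" for s t
    using that assms by (intro stream_eqI_snth) (simp add: fixed_stream_snth)
  then have "\<exists>!s. fixed_stream k s"
    using fixed_stream_exists[OF assms] by blast
  then have "fixed_stream k (THE s. fixed_stream k s)"
    by (rule theI')
  then show ?thesis
    by (simp only: xfix_def fixed_stream_def)
qed

theorem theorem5p5:
  fixes k n :: nat
  assumes "k \<ge> 1"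
  shows "stake n (xfix k) = Wword k (Dset k n) \<and>
    (\<forall>q. (tau_word k ^^ q) (stake n (xfix k)) = Wword k ((\<lambda>p. p + q) ` Dset k n))"
proof -
  note D = Dset_props[OF assms, of n]
  have fin: "finite (Dset k n)"
    using D(1) by (simp add: separated_def)
  then obtain p where p: "Dset k n \<subseteq> {..<p}"
    using finite_nat_bounded by blast
  \<comment> \<open>For any bound \<open>p\<close> of \<open>Dset k n\<close>,
    \<open>block k p\<close> links the two sides: it starts with the word of \<open>Dset k n\<close>
    and is itself a prefix of \<open>xfix k\<close>.\<close>
  obtain v where "block k p = Wword k (Dset k n) @ v"
    using prefix_Wword_block[OF assms D(1) p] by (auto simp: prefix_def)
  moreover obtain t where "xfix k = block k p @- t"
    using fixed_stream_block[OF assms fixed_stream_xfix[OF assms]] by blast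
  moreover have "length (Wword k (Dset k n)) = n"
    using length_Wword[OF assms fin] D(2) by simp
  ultimately have "stake n (xfix k) = Wword k (Dset k n)"
    by (simp add: stake_shift)
  then show ?thesis
    using tau_word_funpow_Wword[OF fin] by simp
qed

end
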